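(* If $A,B\in\mathbb{R}_+^{n\times n}$ commute (under the usual matrix multiplication), then they have a common nonnegative eigenvector: there exist a nonzero entrywise nonnegative vector $v\in\mathbb{R}_+^n$ and $\alpha,\mu\in\mathbb{R}_+$ such that $Av=\alpha v$ and $Bv=\mu v$.
   Context: Here $\mathbb{R}_+=[0,\infty)$, so $\mathbb{R}_+^{n\times n}$ is the set of entrywise nonnegative $n\times n$ real matrices. All operations are the usual ones of linear algebra over $\mathbb{R}$. *)

theory Defs
  imports "HOL-Analysis.Analysis"
begin

end

theory Submission
  imports Defs
begin

text \<open>
  A linear map that sends a nontrivial closed convex cone of nonnegative vectors into itself maps
  some ray of the cone into itself: the rays form a compact convex set, so Brouwer's fixed-point
  theorem applies. For \<open>A\<close> and the whole nonnegative orthant this gives the Perron eigenvector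
  of \<open>A\<close>, with eigenvalue \<open>\<alpha>\<close>, say. The nonnegative vectors \<open>v\<close> with
  \<open>A *v v = \<alpha> *\<^sub>R v\<close> form a nontrivial closed convex cone again, and \<open>B\<close> maps this cone
  into itself: it preserves nonnegativity because its entries are nonnegative, and the eigenspace
  because it commutes with \<open>A\<close>. The same fixed-point argument, applied to \<open>B\<close> on this
  smaller cone, gives the common eigenvector.
\<close>

text \<open>
  The slice \<open>e \<bullet> v = 1\<close> meets every ray of the cone in one point, and the bound
  \<open>norm v \<le> e \<bullet> v\<close> makes it compact. Scaling \<open>f v\<close> back to this slice
  would mean dividing by \<open>e \<bullet> f v\<close>, which breaks down where \<open>f v = 0\<close>. Scaling
  \<open>v + f v\<close> back is always possible, since \<open>e \<bullet> (v + f v) \<ge> 1\<close>, and a fixed point still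
  makes \<open>f v\<close> a multiple of \<open>v\<close>.
\<close>

lemma closed_convex_cone_eigenvector:
  fixes C :: "'a::euclidean_space set" and e :: 'a
  assumes C: "closed C" "convex_cone C"
    and ne: "w \<in> C" "w \<noteq> 0"
    and e: "\<And>v. v \<in> C \<Longrightarrow> norm v \<le> e \<bullet> v"
    and f: "continuous_on C f" "f ` C \<subseteq> C"
  obtains v \<mu> where "v \<in> C" "v \<noteq> 0" "0 \<le> \<mu>" "f v = \<mu> *\<^sub>R v"
proof -
  define K where "K = C \<inter> {v. e \<bullet> v = 1}"
  define g where "g = (\<lambda>v. (1 / (1 + e \<bullet> f v)) *\<^sub>R (v + f v))"
  have scale: "c *\<^sub>R x \<in> C" if "x \<in> C" "0 \<le> c" for c x
    using C(2) that by (simp add: convex_cone_def conic_def)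
  have add: "x + y \<in> C" if "x \<in> C" "y \<in> C" for x y
    using C(2) that by (simp add: convex_cone_add)
  have nonneg: "0 \<le> e \<bullet> x" if "x \<in> C" for x
    using e[OF that] norm_ge_zero[of x] by linarith
  have fC: "f x \<in> C" if "x \<in> C" for x
    using f(2) that by auto
  have "bounded K"
    unfolding bounded_iff K_def using e by fastforce
  moreover have "closed K"
    unfolding K_def using C(1) by (intro closed_Int closed_hyperplane)
  ultimately have "compact K"
    by (simp add: compact_eq_bounded_closed)
  moreover have "convex K"
    unfolding K_def using C(2)
    by (intro convex_Int convex_hyperplane) (simp add: convex_cone_def)
  moreover have "K \<noteq> {}"
  proof -
    have "0 < e \<bullet> w"
      using e[OF ne(1)] ne(2) by (smt (verit) zero_less_norm_iff)
    then have "(1 / (e \<bullet> w)) *\<^sub>R w \<in> K"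
      unfolding K_def using scale[OF ne(1)] by simp
    then show ?thesis by blast
  qed
  moreover have "continuous_on K g"
  proof -
    have "continuous_on K f"
      using f(1) by (rule continuous_on_subset) (simp add: K_def)
    moreover have "1 + e \<bullet> f x \<noteq> 0" if "x \<in> K" for x
      using nonneg[OF fC, of x] that by (simp add: K_def)
    ultimately show ?thesis
      unfolding g_def by (intro continuous_intros) auto
  qed
  moreover have "g \<in> K \<rightarrow> K"
  proof
    fix x assume x: "x \<in> K"
    then have "x \<in> C" "e \<bullet> x = 1" by (auto simp: K_def)
    then show "g x \<in> K"
      using nonneg[OF fC, of x] scale[OF add[OF _ fC], of x x]
      by (simp add: K_def g_def inner_add_right)
  qed
  ultimately obtain v where v: "v \<in> K" "g v = v"
    using brouwer[of K g] by blast
  then have vC: "v \<in> C" "v \<noteq> 0" by (auto simp: K_def)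
  have pos: "0 \<le> e \<bullet> f v" using nonneg[OF fC[OF vC(1)]] .
  have "v + f v = (1 + e \<bullet> f v) *\<^sub>R g v"
    using pos by (simp add: g_def)
  then have "f v = (e \<bullet> f v) *\<^sub>R v"
    using v(2) by (simp add: scaleR_add_left)
  then show thesis using that vC pos by blast
qed

lemma matrix_vector_mult_nonneg:
  fixes A :: "real ^ 'n ^ 'm"
  assumes "\<And>i j. 0 \<le> A $ i $ j" "\<And>j. 0 \<le> v $ j"
  shows "0 \<le> (A *v v) $ i"
  using assms by (simp add: matrix_vector_mult_def sum_nonneg)

text \<open>
  On the nonnegative orthant the sum of the entries, which is the inner product with the all-ones
  vector, is the \<open>\<ell>\<^sup>1\<close> norm and so dominates the Euclidean norm.
\<close>

lemma nonneg_cone_matrix_eigenvector: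
  fixes A :: "real ^ 'n ^ 'n"
  assumes "closed C" "convex_cone C" "w \<in> C" "w \<noteq> 0"
    and nonneg: "\<And>v i. v \<in> C \<Longrightarrow> 0 \<le> v $ i"
    and AC: "\<And>v. v \<in> C \<Longrightarrow> A *v v \<in> C"
  obtains v \<mu> where "v \<in> C" "v \<noteq> 0" "0 \<le> \<mu>" "A *v v = \<mu> *\<^sub>R v"
proof (rule closed_convex_cone_eigenvector[of C w 1 "(*v) A"])
  show "norm v \<le> 1 \<bullet> v" if "v \<in> C" for v
    using norm_le_l1_cart[of v] nonneg[OF that] by (simp add: inner_vec_def)
  show "continuous_on C ((*v) A)"
    by (intro linear_continuous_on matrix_vector_mul_bounded_linear)
  show "(*v) A ` C \<subseteq> C" using AC by auto
qed (use assms in auto)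

theorem corollary3:
  fixes A B :: "real ^ 'n ^ 'n"
  assumes A_nonneg: "\<And>i j. 0 \<le> A $ i $ j"
    and B_nonneg: "\<And>i j. 0 \<le> B $ i $ j"
    and commute: "A ** B = B ** A"
  shows "\<exists>(v :: real ^ 'n) (\<alpha> :: real) (\<mu> :: real).
           v \<noteq> 0 \<and> (\<forall>i. 0 \<le> v $ i) \<and> 0 \<le> \<alpha> \<and> 0 \<le> \<mu> \<and>
           A *v v = \<alpha> *\<^sub>R v \<and> B *v v = \<mu> *\<^sub>R v"
proof -
  define P where "P = {v :: real ^ 'n. \<forall>i. 0 \<le> v $ i}"
  have P: "closed P" "convex_cone P"
  proof -
    have "P = (\<Inter>i. {v. 0 \<le> v $ i})" by (auto simp: P_def)
    moreover have "closed {v :: real ^ 'n. 0 \<le> v $ i}" for i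
      by (intro closed_Collect_le continuous_intros)
    ultimately show "closed P" by auto
    show "convex_cone P"
      by (auto simp: P_def convex_cone_iff)
  qed
  obtain u \<alpha> where u: "u \<in> P" "u \<noteq> 0" and \<alpha>: "0 \<le> \<alpha>" "A *v u = \<alpha> *\<^sub>R u"
  proof (rule nonneg_cone_matrix_eigenvector[of P 1 A])
    show "A *v v \<in> P" if "v \<in> P" for v
      using matrix_vector_mult_nonneg[OF A_nonneg] that by (simp add: P_def)
  qed (use P in \<open>auto simp: P_def\<close>)
  define E where "E = {v. A *v v = \<alpha> *\<^sub>R v}"
  have "subspace E"
    by (auto simp: E_def subspace_def matrix_vector_right_distrib scaleR_add_right
        matrix_vector_mult_scaleR)
  have PE: "closed (P \<inter> E)" "convex_cone (P \<inter> E)"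
    using P \<open>subspace E\<close>
    by (auto simp: closed_Int closed_subspace convex_cone_iff subspace_def)
  obtain v \<mu> where "v \<in> P \<inter> E" "v \<noteq> 0" "0 \<le> \<mu>" "B *v v = \<mu> *\<^sub>R v"
  proof (rule nonneg_cone_matrix_eigenvector[of "P \<inter> E" u B])
    show "B *v v \<in> P \<inter> E" if v: "v \<in> P \<inter> E" for v
    proof
      show "B *v v \<in> P"
        using matrix_vector_mult_nonneg[OF B_nonneg] v by (simp add: P_def)
      have "A *v (B *v v) = B *v (A *v v)"
        by (simp add: matrix_vector_mul_assoc commute)
      then show "B *v v \<in> E"
        using v by (simp add: E_def matrix_vector_mult_scaleR)
    qed
  qed (use PE u \<alpha> in \<open>auto simp: P_def E_def\<close>)
  with \<alpha> show ?thesis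
    by (auto simp: P_def E_def)
qed

end
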